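(* Assume the $ABC$-Conjecture. Let $f(x)\in\mathbb{Z}[x]$ be nonconstant, let $m$ be a positive integer and let $q_1,\dots,q_m\in\mathbb{Z}$. (1) If $f(x)$ is separable with $\deg f(x)>2$, and for each $j$ with $1\le j\le m$ one has $(y+q_j)^2\mid\prod_{i=1}^m(y+q_i)$ in $\mathbb{Z}[y]$, then the equation $$(y+q_1)\cdots(y+q_m)=f(x)$$ has finitely many integer solutions $(x,y)$. (2) If $m>2$, $q_1,\dots,q_m$ are distinct and $f(x)=\prod_{i=1}^k f_i(x)^{l_i}$, where $k$ is a positive integer, $f_i(x)\in\mathbb{Z}[x]$ and the $l_i\ge 2$ are integers for $1\le i\le k$, then the equation $$(y+q_1)\cdots(y+q_m)=f(x)$$ has finitely many integer solutions $(x,y)$.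
   Context: A polynomial is separable if it has no repeated roots (in $\mathbb{C}$). The $ABC$-Conjecture is the following assertion: for every fixed $\epsilon>0$ there is a constant $C_\epsilon$ such that, whenever $a,b,c$ are coprime positive integers with $a+b=c$, one has $c\le C_\epsilon\,N(a,b,c)^{1+\epsilon}$, where $N(a,b,c)$ is the product of the distinct prime divisors of $abc$. *)

theory Defs
  imports Complex_Main "HOL-Computational_Algebra.Computational_Algebra"
begin

definition abc_radical :: "nat \<Rightarrow> nat \<Rightarrow> nat \<Rightarrow> nat" where
  "abc_radical a b c = (\<Prod>p\<in>prime_factors (a * b * c). p)"

definition ABC_conjecture :: bool where
  "ABC_conjecture \<longleftrightarrow>
     (\<forall>\<epsilon>::real. \<epsilon> > 0 \<longrightarrow>
       (\<exists>C::real. \<forall>a b c :: nat.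
          a > 0 \<longrightarrow> b > 0 \<longrightarrow> c > 0 \<longrightarrow> Gcd {a, b, c} = 1 \<longrightarrow> a + b = c \<longrightarrow>
          real c \<le> C * real (abc_radical a b c) powr (1 + \<epsilon>)))"

(* Repeated roots are sought in the complex numbers; rsquarefree says that the polynomial
   is nonzero and has no root of order at least 2 in its own coefficient ring, whence the map. *)
definition separable_poly :: "int poly \<Rightarrow> bool" where
  "separable_poly f \<longleftrightarrow> rsquarefree (map_poly of_int f :: complex poly)"

end

(*
  Both parts reduce to the claim that a separable F in Z[x] of degree d > 2 takes powerful values (every prime
  divisor occurs at least squared) only finitely often: F = f in (1), F = (y + q_1) ... (y + q_m)
  in (2), since the other side of the equation is always powerful.

  Belyi's construction gives beta in Q[x] of some degree D that maps the roots of F and its own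
  critical points into {0, 1}. Then beta (beta - 1) = F beta' S with deg S = D + 1 - d, and
  beta (beta - 1) and F S have the same prime factors. Clearing denominators, ABC applied to
  M beta(n), M (beta(n) - 1), M gives |n|^D << (rad F(n) |S(n)|)^(1 + eps); if F(n) is powerful,
  rad F(n) << |n|^(d/2), so the right-hand side is << |n|^((D + 1 - d/2)(1 + eps)), which is
  smaller than |n|^D for eps = 1/(2D) and large n.
*)
theory Submission
  imports Defs "HOL-Computational_Algebra.Field_as_Ring"
begin

section \<open>Belyi polynomials\<close>

lemma pcompose_power: "(P ^ n) \<circ>\<^sub>p B = (P \<circ>\<^sub>p B) ^ n" for P B :: "'a::comm_ring_1 poly"
  by (induction n) (simp_all add: pcompose_mult pcompose_1)

text \<open>The \<open>degree A + 1\<close> remainders of \<open>B ^ i\<close> modulo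
  \<open>A\<close> with \<open>i \<le> degree A\<close> lie in a space of dimension
  \<open>degree A\<close>, and a linear relation between them is \<open>Q\<close>. In terms of
  roots: \<open>Q\<close> vanishes at the values of \<open>B\<close> at the roots of
  \<open>A\<close>.\<close>

lemma exists_pcompose_dvd:
  fixes A B :: "'a::field poly"
  assumes "A \<noteq> 0"
  obtains Q where "Q \<noteq> 0" "degree Q \<le> degree A" "A dvd Q \<circ>\<^sub>p B"
proof -
  interpret vs: vector_space "smult :: 'a \<Rightarrow> 'a poly \<Rightarrow> 'a poly"
    by unfold_locales (simp_all add: smult_add_right smult_add_left)
  define n where "n = degree A"
  define T :: "'a poly set" where "T = monom 1 ` {..<n}"
  define v where "v i = B ^ i mod A" for i
  have v_span: "v i \<in> vs.span T" for i
  proof -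
    have "v i = (\<Sum>j\<le>degree (v i). monom (coeff (v i) j) j)"
      by (simp add: poly_as_sum_of_monoms)
    also have "\<dots> = (\<Sum>j\<le>degree (v i). smult (coeff (v i) j) (monom 1 j))"
      by (simp add: smult_monom)
    also have "\<dots> \<in> vs.span T"
    proof (rule vs.span_sum)
      fix j assume j: "j \<in> {..degree (v i)}"
      show "smult (coeff (v i) j) (monom 1 j) \<in> vs.span T"
      proof (cases "v i = 0")
        case False
        then have "degree (v i) < n"
          using degree_mod_less[OF assms, of "B ^ i"] by (auto simp: v_def n_def)
        then show ?thesis
          using j by (intro vs.span_scale vs.span_base) (auto simp: T_def)
      qed (simp add: vs.span_zero)
    qed
    finally show ?thesis .
  qed
  have "\<exists>Q. Q \<noteq> 0 \<and> degree Q \<le> n \<and> A dvd Q \<circ>\<^sub>p B"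
  \<comment> \<open>Dependence of the image set does not see repetitions in the family
    \<open>v\<close>, so a coincidence \<open>v i = v j\<close> is treated apart, with
    \<open>monom 1 i - monom 1 j\<close> as the relation.\<close>
  proof (cases "inj_on v {..n}")
    case False
    then obtain i j where ij: "i \<le> n" "j \<le> n" "i \<noteq> j" "v i = v j"
      by (auto simp: inj_on_def)
    let ?Q = "monom 1 i - monom 1 j :: 'a poly"
    have "coeff ?Q i = 1" using ij by simp
    then have "?Q \<noteq> 0" by (metis coeff_0 zero_neq_one)
    moreover have "degree ?Q \<le> n"
      using ij by (intro degree_diff_le) (auto intro: order_trans[OF degree_monom_le])
    moreover have "?Q \<circ>\<^sub>p B = B ^ i - B ^ j"
      by (simp add: pcompose_diff monom_altdef pcompose_power pcompose_pCons)
    moreover have "A dvd B ^ i - B ^ j"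
      using ij(4) by (simp add: v_def mod_eq_dvd_iff)
    ultimately show ?thesis by metis
  next
    case True
    have "card T \<le> n"
      unfolding T_def by (metis card_image_le card_lessThan finite_lessThan)
    moreover have "card (v ` {..n}) = Suc n"
      using True by (simp add: card_image)
    moreover have "finite T" by (simp add: T_def)
    ultimately have "vs.dependent (v ` {..n})"
      using vs.independent_span_bound[of T "v ` {..n}"] v_span by fastforce
    then obtain u w where u: "w \<in> v ` {..n}" "u w \<noteq> 0" "(\<Sum>w\<in>v ` {..n}. smult (u w) w) = 0"
      by (auto simp: vs.dependent_finite)
    let ?Q = "\<Sum>i\<le>n. monom (u (v i)) i"
    have coeff: "coeff ?Q i = (if i \<le> n then u (v i) else 0)" for i
      by (simp add: coeff_sum sum.delta)
    from u obtain i where "i \<le> n" "u (v i) \<noteq> 0" by auto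
    then have "?Q \<noteq> 0" using coeff by (metis coeff_0)
    moreover have "degree ?Q \<le> n"
      by (intro degree_le) (simp add: coeff)
    moreover have "A dvd ?Q \<circ>\<^sub>p B"
    proof -
      have "?Q \<circ>\<^sub>p B = (\<Sum>i\<le>n. smult (u (v i)) (B ^ i))"
        by (simp add: pcompose_sum monom_altdef pcompose_smult pcompose_power pcompose_pCons)
      moreover have "A dvd (\<Sum>i\<le>n. smult (u (v i)) (B ^ i)) - (\<Sum>i\<le>n. smult (u (v i)) (v i))"
        unfolding sum_subtractf[symmetric] smult_diff_right[symmetric]
        by (intro dvd_sum dvd_smult) (simp add: v_def dvd_minus_mod)
      moreover have "(\<Sum>i\<le>n. smult (u (v i)) (v i)) = 0"
        using u(3) True by (simp add: sum.reindex)
      ultimately show ?thesis by simp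
    qed
    ultimately show ?thesis by blast
  qed
  then show ?thesis using that by (auto simp: n_def)
qed

section \<open>Values of a polynomial on Galois orbits of roots\<close>

text \<open>A prime factor \<open>\<pi>\<close> of \<open>A\<close> stands for a Galois orbit of complex roots of \<open>A\<close>; for rational \<open>c\<close>,
  \<open>\<pi> dvd g - [:c:]\<close> says that \<open>g\<close> takes the value \<open>c\<close> on that orbit.\<close>
definition values_at_primes :: "rat poly \<Rightarrow> rat poly \<Rightarrow> rat set \<Rightarrow> bool" where
  "values_at_primes A g T \<longleftrightarrow> (\<forall>\<pi>. prime_elem \<pi> \<longrightarrow> \<pi> dvd A \<longrightarrow> (\<exists>c\<in>T. \<pi> dvd g - [:c:]))"

lemma values_at_primes_mult:
  "values_at_primes (A * B) g T \<longleftrightarrow> values_at_primes A g T \<and> values_at_primes B g T"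
  by (auto simp: values_at_primes_def prime_elem_dvd_mult_iff)

lemma values_at_primes_unit: "is_unit A \<Longrightarrow> values_at_primes A g T"
  by (auto simp: values_at_primes_def prime_elem_def dest: dvd_unit_imp_unit)

lemma values_at_primes_mono:
  "values_at_primes A g T \<Longrightarrow> B dvd A \<Longrightarrow> T \<subseteq> U \<Longrightarrow> values_at_primes B g U"
  by (meson dvd_trans subsetD values_at_primes_def)

text \<open>\<open>P\<close> carries the orbit of \<pi> into the orbit of a single prime factor
  \<rho> of \<open>Q\<close>: composition with \<open>P\<close> respects products, so the prime
  \<pi> divides one of the composed factors.\<close>

lemma prime_dvd_pcompose:
  fixes Q P \<pi> :: "rat poly"
  assumes "prime_elem \<pi>" "Q \<noteq> 0" "\<pi> dvd Q \<circ>\<^sub>p P"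
  obtains \<rho> where "prime_elem \<rho>" "\<rho> dvd Q" "\<pi> dvd \<rho> \<circ>\<^sub>p P"
proof -
  have "\<exists>\<rho>. prime_elem \<rho> \<and> \<rho> dvd Q \<and> \<pi> dvd \<rho> \<circ>\<^sub>p P"
    using assms(2,3)
  proof (induction Q rule: prime_divisors_induct)
    case (unit Q)
    then obtain c where "Q = [:c:]" "c \<noteq> 0"
      by (auto simp: is_unit_poly_iff)
    with unit assms(1) have "is_unit \<pi>"
      by (metis is_unit_triv dvd_unit_imp_unit pcompose_const)
    with assms(1) show ?case by (simp add: prime_elem_def)
  next
    case (factor p Q)
    then have "\<pi> dvd (p \<circ>\<^sub>p P) * (Q \<circ>\<^sub>p P)"
      by (simp add: pcompose_mult)
    with assms(1) have "\<pi> dvd p \<circ>\<^sub>p P \<or> \<pi> dvd Q \<circ>\<^sub>p P"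
      by (simp add: prime_elem_dvd_mult_iff)
    with factor show ?case
      by (metis dvd_mult dvd_triv_left mult_zero_right prime_def)
  qed simp
  with that show ?thesis by blast
qed

lemma values_at_primes_pcompose:
  assumes "Q \<noteq> 0" "values_at_primes Q g T"
  shows "values_at_primes (Q \<circ>\<^sub>p P) (g \<circ>\<^sub>p P) T"
  unfolding values_at_primes_def
proof (intro allI impI)
  fix \<pi> assume "prime_elem \<pi>" "\<pi> dvd Q \<circ>\<^sub>p P"
  then obtain \<rho> where \<rho>: "prime_elem \<rho>" "\<rho> dvd Q" "\<pi> dvd \<rho> \<circ>\<^sub>p P"
    using assms(1) prime_dvd_pcompose by blast
  with assms(2) obtain c where c: "c \<in> T" "\<rho> dvd g - [:c:]"
    by (auto simp: values_at_primes_def)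
  then obtain u where "g - [:c:] = \<rho> * u" by blast
  then have "(g \<circ>\<^sub>p P) - [:c:] = (\<rho> \<circ>\<^sub>p P) * (u \<circ>\<^sub>p P)"
    by (metis pcompose_const pcompose_diff pcompose_mult)
  with \<rho>(3) c(1) show "\<exists>c\<in>T. \<pi> dvd g \<circ>\<^sub>p P - [:c:]"
    by (metis dvd_mult2)
qed

text \<open>The factor theorem for \<open>h\<close> at \<open>c\<close>, with \<open>g\<close>
  substituted for the variable: where \<open>g\<close> takes the value \<open>c\<close>, the
  composition takes the value \<open>poly h c\<close>.\<close>

lemma minus_const_dvd_pcompose: "g - [:c:] dvd h \<circ>\<^sub>p g - [:poly h c:]"
  for g h :: "'a::idom poly"
proof -
  have "[:-c, 1:] dvd h - [:poly h c:]"
    by (simp add: poly_eq_0_iff_dvd[symmetric])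
  then obtain u where "h - [:poly h c:] = [:-c, 1:] * u" by blast
  then have "h \<circ>\<^sub>p g - [:poly h c:] = ([:-c, 1:] \<circ>\<^sub>p g) * (u \<circ>\<^sub>p g)"
    by (metis pcompose_const pcompose_diff pcompose_mult)
  moreover have "[:-c, 1:] \<circ>\<^sub>p g = g - [:c:]"
    by (simp add: pcompose_pCons)
  ultimately show ?thesis by simp
qed

lemma values_at_primes_pcompose_left:
  assumes "values_at_primes A g T"
  shows "values_at_primes A (h \<circ>\<^sub>p g) (poly h ` T)"
  using assms minus_const_dvd_pcompose[of g _ h]
  unfolding values_at_primes_def by (meson dvd_trans image_eqI)

text \<open>Descent: \<open>A\<close> sends its own roots to \<open>0\<close>, and its critical values are roots of a polynomial
  \<open>Q\<close> of smaller degree, to which the induction hypothesis applies.\<close>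
lemma exists_rational_critical_values:
  assumes "A \<noteq> 0"
  shows "\<exists>g T. degree g > 0 \<and> finite T \<and> values_at_primes (A * pderiv g) g T"
  using assms
proof (induction "degree A" arbitrary: A rule: less_induct)
  case (less A)
  show ?case
  proof (cases "degree A = 0")
    case True
    \<comment> \<open>The identity polynomial has derivative 1, so no prime factor occurs and
      \<open>T = {}\<close> serves.\<close>
    then have "is_unit (A * pderiv [:0, 1:])"
      using less.prems by (simp add: is_unit_iff_degree pderiv_pCons)
    then show ?thesis
      by (intro exI[of _ "[:0, 1:]"] exI[of _ "{}"] conjI values_at_primes_unit) auto
  next
    case False
    then have A': "pderiv A \<noteq> 0" "degree (pderiv A) < degree A"
      by (auto simp: pderiv_eq_0_iff degree_pderiv)
    obtain Q where Q: "Q \<noteq> 0" "degree Q \<le> degree (pderiv A)" "pderiv A dvd Q \<circ>\<^sub>p A"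
      using exists_pcompose_dvd[OF A'(1)] by blast
    from less.hyps[of Q] Q A' obtain g T where
      gT: "degree g > 0" "finite T" "values_at_primes (Q * pderiv g) g T"
      by auto
    \<comment> \<open>By the chain rule the factors to control are \<open>A\<close>,
      \<open>pderiv A\<close> and \<open>pderiv g \<circ>\<^sub>p A\<close>. On the first the value
      is \<open>poly g 0\<close>; on the other two the values lie in \<open>T\<close>.\<close>
    let ?U = "insert (poly g 0) T"
    have "values_at_primes A A {0}"
      by (simp add: values_at_primes_def)
    then have "values_at_primes A (g \<circ>\<^sub>p A) {poly g 0}"
      using values_at_primes_pcompose_left by fastforce
    moreover have "values_at_primes (Q \<circ>\<^sub>p A) (g \<circ>\<^sub>p A) T"
      using Q(1) gT(3) by (simp add: values_at_primes_pcompose values_at_primes_mult)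
    moreover have "values_at_primes (pderiv g \<circ>\<^sub>p A) (g \<circ>\<^sub>p A) T"
      using gT by (intro values_at_primes_pcompose) (auto simp: pderiv_eq_0_iff values_at_primes_mult)
    ultimately have "values_at_primes A (g \<circ>\<^sub>p A) ?U" "values_at_primes (pderiv A) (g \<circ>\<^sub>p A) ?U"
      "values_at_primes (pderiv g \<circ>\<^sub>p A) (g \<circ>\<^sub>p A) ?U"
      using Q(3) by (auto elim: values_at_primes_mono)
    then have "values_at_primes (A * pderiv (g \<circ>\<^sub>p A)) (g \<circ>\<^sub>p A) ?U"
      by (simp add: pderiv_pcompose values_at_primes_mult)
    moreover have "degree (g \<circ>\<^sub>p A) > 0"
      using gT(1) False by (simp add: degree_pcompose)
    ultimately show ?thesis using gT(2) by blast
  qed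
qed

section \<open>Moving rational points into {0, 1}\<close>

lemma pderiv_power_mult_power:
  fixes p q :: "'a::{comm_ring_1,semiring_no_zero_divisors} poly"
  shows "pderiv (p ^ Suc m * q ^ Suc n) =
    p ^ m * q ^ n * (smult (of_nat (Suc m)) (q * pderiv p) + smult (of_nat (Suc n)) (p * pderiv q))"
  unfolding pderiv_mult pderiv_power_Suc by (simp add: algebra_simps del: of_nat_Suc)

text \<open>Take \<open>K (x - s) ^ a (t - x) ^ b\<close>: its only critical point besides \<open>s\<close> and \<open>t\<close> is the rational
  point dividing \<open>[s, t]\<close> in the ratio \<open>a : b\<close>, and \<open>a\<close>, \<open>b\<close> are chosen to make this \<open>r\<close>.\<close>
lemma exists_merging_poly:
  fixes r s t :: rat
  assumes "s < r" "r < t"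
  obtains \<psi> where "degree \<psi> > 0" "poly \<psi> s = 0" "poly \<psi> t = 0" "poly \<psi> r = 1"
    "values_at_primes (pderiv \<psi>) \<psi> {0, 1}"
proof -
  obtain m n where mn: "quotient_of ((r - s) / (t - r)) = (m, n)"
    by force
  have n: "n > 0" using quotient_of_denom_pos[OF mn] .
  have frac: "(r - s) / (t - r) = of_int m / of_int n"
    using quotient_of_div[OF mn] .
  moreover have "(r - s) / (t - r) > 0" using assms by simp
  ultimately have m: "m > 0" using n by (simp add: zero_less_divide_iff)
  \<comment> \<open>The exponents in \<psi> are \<open>m\<close> and \<open>n\<close>, written as
    successors so that the derivative carries the exponents \<open>a\<close> and
    \<open>b\<close>.\<close>
  define a b where "a = nat m - 1" and "b = nat n - 1"
  have ab: "of_nat (Suc a) = (of_int m :: rat)" "of_nat (Suc b) = (of_int n :: rat)"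
    using m n by (simp_all add: a_def b_def)
  have eq: "of_nat (Suc a) * (t - r) = of_nat (Suc b) * (r - s)"
    unfolding ab using frac assms n by (simp add: field_simps)
  define K where "K = 1 / ((r - s) ^ Suc a * (t - r) ^ Suc b)"
  have K: "K \<noteq> 0" using assms by (simp add: K_def)
  define \<psi> where "\<psi> = smult K ([:-s, 1:] ^ Suc a * [:t, -1:] ^ Suc b)"
  have "poly \<psi> s = 0" "poly \<psi> t = 0" by (simp_all add: \<psi>_def)
  moreover have r1: "poly \<psi> r = 1"
  proof -
    have "poly \<psi> r = K * ((r - s) ^ Suc a * (t - r) ^ Suc b)"
      by (simp add: \<psi>_def del: power_Suc)
    then show ?thesis using assms by (simp add: K_def del: power_Suc)
  qed
  moreover have "degree \<psi> > 0"
    using K by (simp add: \<psi>_def degree_mult_eq degree_power_eq del: power_Suc)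
  moreover have "values_at_primes (pderiv \<psi>) \<psi> {0, 1}"
  proof -
    \<comment> \<open>This linear factor is what remains of the derivative after the powers are
      split off; by \<open>eq\<close> its root is \<open>r\<close>.\<close>
    let ?w = "smult (of_nat (Suc a)) [:t, -1:] - smult (of_nat (Suc b)) [:-s, 1:]"
    have "?w = smult (- of_nat (Suc a) - of_nat (Suc b)) [:-r, 1:]"
      using eq by (simp add: algebra_simps)
    moreover have "- of_nat (Suc a) - of_nat (Suc b) \<noteq> (0::rat)"
      using ab m n by linarith
    ultimately obtain c where w: "?w = smult c [:-r, 1:]" "c \<noteq> 0" by blast
    have "smult (of_nat (Suc a)) ([:t, -1:] * pderiv [:-s, 1:]) +
        smult (of_nat (Suc b)) ([:-s, 1:] * pderiv [:t, -1:]) = ?w"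
      by (simp add: pderiv_pCons del: of_nat_Suc)
    then have "pderiv \<psi> = smult K ([:-s, 1:] ^ a * [:t, -1:] ^ b * ?w)"
      unfolding \<psi>_def pderiv_smult pderiv_power_mult_power by simp
    also have "\<dots> = smult (K * c) ([:-s, 1:] ^ a * [:t, -1:] ^ b * [:-r, 1:])"
      unfolding w(1) by (simp only: mult_smult_right smult_smult)
    finally have d: "pderiv \<psi> = \<dots>" .
    show ?thesis
      unfolding values_at_primes_def
    proof (intro allI impI)
      fix \<pi> assume \<pi>: "prime_elem \<pi>" "\<pi> dvd pderiv \<psi>"
      then have "\<pi> dvd [:-s, 1:] ^ a * [:t, -1:] ^ b * [:-r, 1:]"
        unfolding d using K w(2) by (simp add: dvd_smult_iff)
      then consider "\<pi> dvd [:-s, 1:]" | "\<pi> dvd [:t, -1:]" | "\<pi> dvd [:-r, 1:]"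
        using \<pi>(1) by (meson prime_elem_dvd_mult_iff prime_elem_dvd_power)
      then show "\<exists>c\<in>{0, 1}. \<pi> dvd \<psi> - [:c:]"
      proof cases
        case 3
        have "[:-r, 1:] dvd \<psi> - [:1:]"
          using r1 by (simp add: poly_eq_0_iff_dvd[symmetric])
        with 3 show ?thesis by (meson dvd_trans insertCI)
      next
        case 1
        have "[:-s, 1:] dvd \<psi>" unfolding \<psi>_def power_Suc by (intro dvd_smult dvd_mult2 dvd_refl)
        with 1 show ?thesis by (auto intro: dvd_trans)
      next
        case 2
        have "[:t, -1:] dvd \<psi>" unfolding \<psi>_def power_Suc by (intro dvd_smult dvd_mult dvd_triv_left)
        with 2 show ?thesis by (auto intro: dvd_trans)
      qed
    qed
  qed
  ultimately show ?thesis using that by blast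
qed

text \<open>While \<open>T\<close> has a point \<open>r\<close> strictly between its extremes
  \<open>s\<close> and \<open>t\<close>, the merging polynomial identifies \<open>s\<close> with
  \<open>t\<close> and so shrinks \<open>T\<close>. A set of at most two points is handled by an
  affine map.\<close>

lemma exists_poly_to_01:
  assumes "finite T"
  shows "\<exists>h. degree h > 0 \<and> poly h ` T \<subseteq> {0, 1} \<and> values_at_primes (pderiv h) h {0, 1}"
  using assms
proof (induction "card T" arbitrary: T rule: less_induct)
  case (less T)
  have affine: "\<exists>h. degree h > 0 \<and> poly h ` T \<subseteq> {0, 1} \<and> values_at_primes (pderiv h) h {0, 1}"
    if "T \<subseteq> {s, t}" "s < t" for s t :: rat
  proof (intro exI conjI)
    let ?h = "[:- s / (t - s), 1 / (t - s):]"
    show "degree ?h > 0" using that by simp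
    have "poly ?h x = (x - s) / (t - s)" for x
      by (simp add: diff_divide_distrib)
    with that show "poly ?h ` T \<subseteq> {0, 1}" by (auto simp del: poly_pCons)
    show "values_at_primes (pderiv ?h) ?h {0, 1}"
      using that by (intro values_at_primes_unit) (simp add: pderiv_pCons is_unit_triv)
  qed
  show ?case
  proof (cases "T = {}")
    case True
    then show ?thesis using affine[of 0 1] by auto
  next
    case False
    define s t where "s = Min T" and "t = Max T"
    have st: "s \<in> T" "t \<in> T" "\<And>r. r \<in> T \<Longrightarrow> s \<le> r \<and> r \<le> t"
      using less.prems False by (auto simp: s_def t_def)
    show ?thesis
    proof (cases "T \<subseteq> {s, t}")
      case True
      show ?thesis
      proof (cases "s = t")
        case True
        then show ?thesis using affine[of s "s + 1"] \<open>T \<subseteq> {s, t}\<close> by auto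
      next
        case False
        then show ?thesis using affine[of s t] st \<open>T \<subseteq> {s, t}\<close> by force
      qed
    next
      case False
      then obtain r where r: "r \<in> T" "s < r" "r < t"
        using st(3) by force
      from exists_merging_poly[OF r(2,3)] obtain \<psi> where
        \<psi>: "degree \<psi> > 0" "poly \<psi> s = 0" "poly \<psi> t = 0" "poly \<psi> r = 1"
          "values_at_primes (pderiv \<psi>) \<psi> {0, 1}"
        by blast
      have "\<not> inj_on (poly \<psi>) T"
      proof
        assume "inj_on (poly \<psi>) T"
        then have "s = t" using \<psi>(2,3) st(1,2) by (metis inj_onD)
        with r show False by simp
      qed
      then have "card (poly \<psi> ` T) < card T"
        using less.prems by (metis card_image_le eq_card_imp_inj_on le_neq_implies_less)
      with less obtain h where h: "degree h > 0" "poly h ` poly \<psi> ` T \<subseteq> {0, 1}"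
        "values_at_primes (pderiv h) h {0, 1}"
        by (meson finite_imageI)
      \<comment> \<open>Since 0 and 1 are among the points handed to \<open>h\<close>, they stay in
        {0, 1}, and with them the critical values of \<psi>.\<close>
      have "{0, 1} \<subseteq> poly \<psi> ` T"
        using \<psi> st r by (metis empty_subsetI imageI insert_subset)
      then have "poly h ` {0, 1} \<subseteq> {0, 1}" using h(2) by blast
      with values_at_primes_mono[OF values_at_primes_pcompose_left[OF \<psi>(5)] dvd_refl]
      have "values_at_primes (pderiv \<psi>) (h \<circ>\<^sub>p \<psi>) {0, 1}" .
      moreover have "values_at_primes (pderiv h \<circ>\<^sub>p \<psi>) (h \<circ>\<^sub>p \<psi>) {0, 1}"
        using h by (intro values_at_primes_pcompose) (auto simp: pderiv_eq_0_iff)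
      ultimately have "values_at_primes (pderiv (h \<circ>\<^sub>p \<psi>)) (h \<circ>\<^sub>p \<psi>) {0, 1}"
        by (simp add: pderiv_pcompose values_at_primes_mult)
      moreover have "degree (h \<circ>\<^sub>p \<psi>) > 0"
        using h \<psi> by (simp add: degree_pcompose)
      moreover have "poly (h \<circ>\<^sub>p \<psi>) ` T \<subseteq> {0, 1}"
        using h(2) by (auto simp: poly_pcompose)
      ultimately show ?thesis by blast
    qed
  qed
qed

text \<open>First \<open>g\<close> makes all relevant values rational, then \<open>h\<close>
  collapses these to {0, 1}; the chain rule splits the critical points of the composition into those
  of \<open>g\<close> and the preimages of those of \<open>h\<close>.\<close>

theorem exists_belyi_poly:
  assumes "A \<noteq> 0"
  obtains \<beta> where "degree \<beta> > 0" "values_at_primes (A * pderiv \<beta>) \<beta> {0, 1}"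
proof -
  obtain g T where g: "degree g > 0" "finite T" "values_at_primes (A * pderiv g) g T"
    using exists_rational_critical_values[OF assms] by blast
  obtain h where h: "degree h > 0" "poly h ` T \<subseteq> {0, 1}" "values_at_primes (pderiv h) h {0, 1}"
    using exists_poly_to_01[OF g(2)] by blast
  have "values_at_primes (A * pderiv g) (h \<circ>\<^sub>p g) {0, 1}"
    using values_at_primes_mono[OF values_at_primes_pcompose_left[OF g(3)] dvd_refl h(2)] .
  moreover have "values_at_primes (pderiv h \<circ>\<^sub>p g) (h \<circ>\<^sub>p g) {0, 1}"
    using h by (intro values_at_primes_pcompose) (auto simp: pderiv_eq_0_iff)
  ultimately have "values_at_primes (A * pderiv (h \<circ>\<^sub>p g)) (h \<circ>\<^sub>p g) {0, 1}"
    by (simp add: pderiv_pcompose values_at_primes_mult)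
  moreover have "degree (h \<circ>\<^sub>p g) > 0"
    using h g by (simp add: degree_pcompose)
  ultimately show ?thesis using that by blast
qed

section \<open>The factorisation of \<beta> (\<beta> - 1)\<close>

text \<open>If \<open>p = \<pi> ^ e * h\<close> with \<open>h\<close> prime to \<pi> and \<pi>^e
  divided \<open>pderiv p\<close>, then \<pi> would divide \<open>pderiv \<pi>\<close>, which is
  nonzero of smaller degree.\<close>

lemma multiplicity_pderiv_less:
  fixes p \<pi> :: "rat poly"
  assumes "prime_elem \<pi>" "\<pi> dvd p" "degree p > 0"
  shows "multiplicity \<pi> (pderiv p) < multiplicity \<pi> p"
proof -
  have \<pi>: "\<not> is_unit \<pi>" "\<pi> \<noteq> 0" using assms(1) by (auto simp: prime_elem_def)
  have p: "p \<noteq> 0" using assms(3) by auto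
  define e where "e = multiplicity \<pi> p"
  have "e > 0" using assms \<pi> p by (simp add: e_def multiplicity_gt_zero_iff)
  then obtain k where k: "e = Suc k" by (cases e) auto
  obtain h where h: "p = \<pi> ^ e * h" "\<not> \<pi> dvd h"
    using multiplicity_decompose'[of p \<pi>] p \<pi> by (auto simp: e_def)
  have "\<not> \<pi> ^ e dvd pderiv p"
  proof
    assume *: "\<pi> ^ e dvd pderiv p"
    have "pderiv p = \<pi> ^ e * pderiv h + \<pi> ^ k * smult (of_nat e) (pderiv \<pi> * h)"
      unfolding h(1) k pderiv_mult pderiv_power_Suc by (simp add: algebra_simps del: of_nat_Suc)
    with * have "\<pi> ^ k * \<pi> dvd \<pi> ^ k * smult (of_nat e) (pderiv \<pi> * h)"
      by (metis dvd_add_right_iff dvd_triv_left k power_Suc2)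
    then have "\<pi> dvd smult (of_nat e) (pderiv \<pi> * h)"
      unfolding mult_smult_right[symmetric] using \<pi> by (simp del: mult_smult_right)
    then have "\<pi> dvd pderiv \<pi> * h"
      using \<open>e > 0\<close> by (simp add: dvd_smult_iff)
    then have d: "\<pi> dvd pderiv \<pi>"
      using assms(1) h(2) by (simp add: prime_elem_dvd_mult_iff)
    have "degree \<pi> > 0" using \<pi> by (simp add: is_unit_iff_degree)
    then have "pderiv \<pi> \<noteq> 0" "degree (pderiv \<pi>) < degree \<pi>"
      by (auto simp: pderiv_eq_0_iff degree_pderiv)
    with d show False by (meson dvd_imp_degree_le not_le)
  qed
  moreover have "pderiv p \<noteq> 0" using assms(3) by (auto simp: pderiv_eq_0_iff)
  ultimately show ?thesis
    using \<pi> by (simp add: e_def multiplicity_lessI)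
qed

text \<open>Each prime factor of \<open>W\<close>, counted with multiplicity, is absorbed by one
  more copy of \<open>R\<close>.\<close>

lemma dvd_power_if_prime_divisors:
  fixes W R :: "'a::factorial_semiring"
  assumes "W \<noteq> 0" "\<And>\<pi>. prime \<pi> \<Longrightarrow> \<pi> dvd W \<Longrightarrow> \<pi> dvd R"
  shows "\<exists>k. W dvd R ^ k"
  using assms
proof (induction W rule: prime_divisors_induct)
  case (unit W)
  then show ?case by (auto intro: exI[of _ 0])
next
  case (factor p W)
  then obtain k where "W dvd R ^ k" by auto
  with factor have "p * W dvd R ^ Suc k"
    by (auto intro!: mult_dvd_mono)
  then show ?case by blast
qed simp

text \<open>A prime factor of \<open>\<beta> (\<beta> - 1)\<close> of multiplicity \<open>e\<close> has multiplicity \<open>e - 1\<close> in \<open>\<beta>'\<close>, and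
  \<open>\<beta>'\<close> has no other prime factors, so the quotient \<open>f S\<close> is the squarefree part.\<close>
lemma belyi_factorisation:
  fixes f :: "rat poly"
  assumes "squarefree f"
  obtains \<beta> S k where "degree \<beta> > 0" "\<beta> * (\<beta> - 1) = f * pderiv \<beta> * S"
    "\<beta> * (\<beta> - 1) dvd (f * S) ^ k"
proof -
  have f: "f \<noteq> 0" using assms by auto
  obtain \<beta> where \<beta>: "degree \<beta> > 0" "values_at_primes (f * pderiv \<beta>) \<beta> {0, 1}"
    using exists_belyi_poly[OF f] by blast
  let ?W = "\<beta> * (\<beta> - 1)"
  have d1: "degree (\<beta> - 1) = degree \<beta>"
    using \<beta>(1) degree_add_eq_left[of "-1" \<beta>] by simp
  have nz: "\<beta> \<noteq> 0" "\<beta> - 1 \<noteq> 0" "pderiv \<beta> \<noteq> 0"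
    using \<beta>(1) d1 by (auto simp: pderiv_eq_0_iff)
  have dvd: "\<pi> dvd ?W" if "prime \<pi>" "\<pi> dvd f * pderiv \<beta>" for \<pi>
    using \<beta>(2) that by (auto simp: values_at_primes_def one_pCons)
  have key: "multiplicity \<pi> (pderiv \<beta>) < multiplicity \<pi> ?W" if \<pi>: "prime \<pi>" "\<pi> dvd ?W" for \<pi>
  proof -
    have mult: "multiplicity \<pi> ?W = multiplicity \<pi> \<beta> + multiplicity \<pi> (\<beta> - 1)"
      using \<pi> nz by (simp add: prime_elem_multiplicity_mult_distrib)
    from \<pi> have "\<pi> dvd \<beta> \<or> \<pi> dvd \<beta> - 1" by (simp add: prime_dvd_mult_iff)
    then show ?thesis
    proof
      assume "\<pi> dvd \<beta>"
      then show ?thesis using multiplicity_pderiv_less[of \<pi> \<beta>] \<pi> \<beta>(1) mult by simp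
    next
      assume "\<pi> dvd \<beta> - 1"
      moreover have "pderiv (\<beta> - 1) = pderiv \<beta>" by (simp add: pderiv_diff)
      ultimately show ?thesis
        using multiplicity_pderiv_less[of \<pi> "\<beta> - 1"] \<pi> \<beta>(1) d1 mult by simp
    qed
  qed
  \<comment> \<open>Compared prime by prime: \<open>f\<close> contributes at most 1 because it is
    squarefree, and \<open>key\<close> leaves room for exactly that.\<close>
  have "f * pderiv \<beta> dvd ?W"
  proof (rule multiplicity_le_imp_dvd)
    fix \<pi> :: "rat poly" assume \<pi>: "prime \<pi>"
    have *: "multiplicity \<pi> (f * pderiv \<beta>) = multiplicity \<pi> f + multiplicity \<pi> (pderiv \<beta>)"
      using \<pi> f nz by (simp add: prime_elem_multiplicity_mult_distrib)
    show "multiplicity \<pi> (f * pderiv \<beta>) \<le> multiplicity \<pi> ?W"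
    proof (cases "\<pi> dvd f * pderiv \<beta>")
      case True
      moreover have "multiplicity \<pi> f \<le> 1"
        using assms \<pi> f by (simp add: squarefree_factorial_semiring'')
      ultimately show ?thesis using key[OF \<pi> dvd[OF \<pi> True]] * by linarith
    qed (simp add: not_dvd_imp_multiplicity_0)
  qed (use f nz in simp)
  then obtain S where S: "?W = f * pderiv \<beta> * S" by blast
  have "\<exists>k. ?W dvd (f * S) ^ k"
  proof (rule dvd_power_if_prime_divisors)
    fix \<pi> assume \<pi>: "prime \<pi>" "\<pi> dvd ?W"
    have "f * S \<noteq> 0" using S nz by auto
    then have "multiplicity \<pi> ?W = multiplicity \<pi> (pderiv \<beta>) + multiplicity \<pi> (f * S)"
      using \<pi> nz S by (simp add: prime_elem_multiplicity_mult_distrib[symmetric] mult_ac)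
    then have "multiplicity \<pi> (f * S) > 0" using key[OF \<pi>] by simp
    then show "\<pi> dvd f * S"
      using not_dvd_imp_multiplicity_0 by force
  qed (use nz in simp)
  with that \<beta>(1) S show ?thesis by blast
qed

section \<open>The radical and the ABC conjecture\<close>

abbreviation rad :: "nat \<Rightarrow> nat" where
  "rad n \<equiv> \<Prod>(prime_factors n)"

lemma rad_mono:
  assumes "n > 0" "\<And>p. prime p \<Longrightarrow> p dvd m \<Longrightarrow> p dvd n"
  shows "rad m \<le> rad n"
proof (rule dvd_imp_le)
  have "prime_factors m \<subseteq> prime_factors n"
    using assms by (auto simp: in_prime_factors_iff)
  then show "rad m dvd rad n"
    by (intro prod_dvd_prod_subset) auto
  show "rad n > 0"
    by (intro prod_pos) (auto simp: in_prime_factors_iff prime_gt_0_nat)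
qed

lemma rad_le:
  assumes "n > 0"
  shows "rad n \<le> n"
proof -
  have "rad n \<le> (\<Prod>p\<in>prime_factors n. p ^ multiplicity p n)"
    by (intro prod_mono)
      (auto simp: in_prime_factors_iff prime_gt_0_nat Suc_le_eq prime_multiplicity_gt_zero_iff intro!: self_le_power)
  also have "\<dots> = n" using assms by (simp add: prod_prime_factors)
  finally show ?thesis .
qed

lemma rad_mult_le:
  assumes "m > 0" "n > 0"
  shows "rad (m * n) \<le> rad m * rad n"
proof -
  have "rad (m * n) = \<Prod>(prime_factors m \<union> prime_factors n)"
    using assms by (simp add: prime_factors_product)
  also have "\<dots> * \<Prod>(prime_factors m \<inter> prime_factors n) = rad m * rad n"
    by (rule prod.union_inter) auto
  finally have "rad m * rad n = rad (m * n) * \<Prod>(prime_factors m \<inter> prime_factors n)" ..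
  moreover have "\<Prod>(prime_factors m \<inter> prime_factors n) \<ge> 1"
    by (intro prod_ge_1) (auto simp: in_prime_factors_iff prime_gt_0_nat Suc_le_eq)
  ultimately show ?thesis by simp
qed

text \<open>The saving for powerful numbers: the radical is at most the square root.\<close>

lemma rad_square_le:
  assumes "n > 0" "\<And>p. prime p \<Longrightarrow> p dvd n \<Longrightarrow> p ^ 2 dvd n"
  shows "(rad n) ^ 2 \<le> n"
proof -
  have "(rad n) ^ 2 = (\<Prod>p\<in>prime_factors n. p ^ 2)"
    by (simp add: prod_power_distrib)
  also have "\<dots> \<le> (\<Prod>p\<in>prime_factors n. p ^ multiplicity p n)"
  proof (rule prod_mono)
    fix p assume "p \<in> prime_factors n"
    then have p: "prime p" "p dvd n" by (auto simp: in_prime_factors_iff)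
    then have "multiplicity p n \<ge> 2"
      using assms by (intro multiplicity_geI) auto
    then show "0 \<le> p ^ 2 \<and> p ^ 2 \<le> p ^ multiplicity p n"
      using p(1) by (auto intro!: power_increasing simp: Suc_le_eq prime_gt_0_nat)
  qed
  also have "\<dots> = n" using assms(1) by (simp add: prod_prime_factors)
  finally show ?thesis .
qed

text \<open>The summands \<open>u\<close> and \<open>M\<close> need not be coprime. Dividing by
  their gcd, which is at most \<open>M\<close>, costs a factor of at most \<open>M\<close> on the
  left and does not increase the radical on the right.\<close>

lemma ABC_fixed_summand:
  fixes \<epsilon> :: real and M :: nat
  assumes "ABC_conjecture" "\<epsilon> > 0" "M > 0"
  obtains C where "C > 0"
    "\<And>u. u > 0 \<Longrightarrow> real (u + M) \<le> C * real (rad (u * M * (u + M))) powr (1 + \<epsilon>)"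
proof -
  obtain C0 where C0: "\<And>a b c :: nat. a > 0 \<Longrightarrow> b > 0 \<Longrightarrow> c > 0 \<Longrightarrow> Gcd {a, b, c} = 1 \<Longrightarrow>
      a + b = c \<Longrightarrow> real c \<le> C0 * real (abc_radical a b c) powr (1 + \<epsilon>)"
    using assms unfolding ABC_conjecture_def by meson
  \<comment> \<open>The maximum makes the constant positive, as the monotonicity arguments
    require.\<close>
  define C where "C = max C0 1"
  have bound: "real (u + M) \<le> (M * C) * real (rad (u * M * (u + M))) powr (1 + \<epsilon>)"
    if u: "u > 0" for u
  proof -
    define d where "d = gcd u M"
    define a b where "a = u div d" and "b = M div d"
    have d: "d > 0" "d \<le> M" using assms(3) by (auto simp: d_def intro: dvd_imp_le)
    have uM: "u = d * a" "M = d * b" by (simp_all add: a_def b_def d_def)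
    have "coprime a b"
      using u by (simp add: a_def b_def d_def div_gcd_coprime)
    then have "Gcd {a, b, a + b} = 1"
      by (simp add: gcd.assoc[symmetric])
    moreover have "a > 0" "b > 0" using u assms(3) uM by auto
    ultimately have "real (a + b) \<le> C0 * real (abc_radical a b (a + b)) powr (1 + \<epsilon>)"
      by (intro C0) auto
    also have "abc_radical a b (a + b) = rad (a * b * (a + b))"
      by (simp add: abc_radical_def)
    also have "C0 * real (rad (a * b * (a + b))) powr (1 + \<epsilon>) \<le>
        C * real (rad (u * M * (u + M))) powr (1 + \<epsilon>)"
    proof (intro mult_mono powr_mono2)
      have "a * b * (a + b) dvd u * M * (u + M)"
        unfolding uM by (intro mult_dvd_mono) (auto simp: distrib_left[symmetric])
      then show "real (rad (a * b * (a + b))) \<le> real (rad (u * M * (u + M)))"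
        unfolding of_nat_le_iff using u assms(3) by (intro rad_mono) (auto intro: dvd_trans)
    qed (use assms in \<open>auto simp: C_def intro: prod_nonneg\<close>)
    finally have *: "real (a + b) \<le> \<dots>" .
    have "real (u + M) = d * real (a + b)"
      by (simp add: uM distrib_left)
    also have "\<dots> \<le> M * (C * real (rad (u * M * (u + M))) powr (1 + \<epsilon>))"
      using * d(2) by (intro mult_mono) auto
    finally show ?thesis by simp
  qed
  show ?thesis
    by (rule that[OF _ bound]) (use assms in \<open>auto simp: C_def\<close>)
qed

section \<open>Growth of integer polynomials and clearing denominators\<close>

lemma poly_int_upper_bound:
  fixes p :: "int poly"
  assumes "degree p \<le> k"
  obtains K where "K > 0" "\<And>n. n \<noteq> 0 \<Longrightarrow> \<bar>poly p n\<bar> \<le> K * \<bar>n\<bar> ^ k"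
proof -
  \<comment> \<open>Adding 1 keeps \<open>K\<close> positive for the zero polynomial.\<close>
  define K where "K = (\<Sum>i\<le>degree p. \<bar>coeff p i\<bar>) + 1"
  have bound: "\<bar>poly p n\<bar> \<le> K * \<bar>n\<bar> ^ k" if "n \<noteq> 0" for n
  proof -
    have "\<bar>poly p n\<bar> \<le> (\<Sum>i\<le>degree p. \<bar>coeff p i * n ^ i\<bar>)"
      unfolding poly_altdef by (rule sum_abs)
    also have "\<dots> \<le> (\<Sum>i\<le>degree p. \<bar>coeff p i\<bar> * \<bar>n\<bar> ^ k)"
      unfolding abs_mult power_abs using assms that
      by (intro sum_mono mult_left_mono power_increasing) auto
    also have "\<dots> \<le> K * \<bar>n\<bar> ^ k"
      by (simp add: K_def sum_distrib_right distrib_right)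
    finally show ?thesis .
  qed
  show ?thesis
    by (rule that[OF _ bound]) (auto simp: K_def intro: add_nonneg_pos sum_nonneg)
qed

text \<open>The leading coefficient is a nonzero integer, so the leading term is at least
  \<open>\<bar>n\<bar> ^ degree p\<close>; for large \<open>n\<close> the lower terms cancel at most
  half of that.\<close>

lemma poly_int_lower_bound:
  fixes p :: "int poly"
  assumes "degree p > 0"
  obtains N where "N > 0" "\<And>n. \<bar>n\<bar> \<ge> N \<Longrightarrow> \<bar>n\<bar> ^ degree p \<le> 2 * \<bar>poly p n\<bar>"
proof -
  define D r where "D = degree p" and "r = p - monom (lead_coeff p) D"
  obtain k where k: "D = Suc k" using assms by (cases D) (auto simp: D_def)
  have "degree r \<le> k"
  proof (rule degree_le, intro allI impI)
    fix i assume "k < i"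
    then show "coeff r i = 0"
      by (cases "i = D") (auto simp: r_def D_def[symmetric] k intro: coeff_eq_0)
  qed
  then obtain K where K: "K > 0" "\<And>n. n \<noteq> 0 \<Longrightarrow> \<bar>poly r n\<bar> \<le> K * \<bar>n\<bar> ^ k"
    using poly_int_upper_bound by blast
  have bound: "\<bar>n\<bar> ^ D \<le> 2 * \<bar>poly p n\<bar>" if n: "\<bar>n\<bar> \<ge> 2 * K" for n
  proof -
    have "lead_coeff p \<noteq> 0" using assms by auto
    then have "1 \<le> \<bar>lead_coeff p\<bar>" by linarith
    then have "1 * \<bar>n\<bar> ^ D \<le> \<bar>lead_coeff p\<bar> * \<bar>n\<bar> ^ D"
      by (rule mult_right_mono) simp
    moreover have "poly p n = lead_coeff p * n ^ D + poly r n"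
      by (simp add: r_def poly_monom)
    then have "\<bar>lead_coeff p\<bar> * \<bar>n\<bar> ^ D \<le> \<bar>poly p n\<bar> + \<bar>poly r n\<bar>"
      by (simp add: abs_mult[symmetric] power_abs[symmetric])
    moreover have "2 * \<bar>poly r n\<bar> \<le> \<bar>n\<bar> ^ D"
    proof -
      have "n \<noteq> 0" using n K(1) by auto
      then have "2 * \<bar>poly r n\<bar> \<le> 2 * (K * \<bar>n\<bar> ^ k)" using K(2) by simp
      also have "\<dots> \<le> \<bar>n\<bar> * \<bar>n\<bar> ^ k"
        using mult_right_mono[OF n, of "\<bar>n\<bar> ^ k"] by (simp add: mult_ac)
      finally show ?thesis by (simp add: k)
    qed
    ultimately show ?thesis by linarith
  qed
  show ?thesis by (rule that[of "2 * K"]) (use K(1) bound in \<open>auto simp: D_def\<close>)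
qed

lemma clear_denominators:
  fixes p :: "rat poly"
  obtains M :: int and P where "M > 0" "smult (of_int M) p = map_poly of_int P"
proof -
  have "\<exists>M P. M > (0::int) \<and> smult (of_int M) p = map_poly of_int P"
  proof (induction p)
    case 0
    show ?case by (auto intro: exI[of _ 1] exI[of _ 0])
  next
    case (pCons a p)
    then obtain M P where MP: "M > 0" "smult (of_int M) p = map_poly of_int P" by blast
    obtain m n where mn: "quotient_of a = (m, n)" by force
    have n: "n > 0" using quotient_of_denom_pos[OF mn] .
    have a: "a = of_int m / of_int n" using quotient_of_div[OF mn] .
    have "smult (of_int (n * M)) (pCons a p) = pCons (of_int (M * m)) (smult (of_int n) (smult (of_int M) p))"
      using n by (simp add: a)
    also have "\<dots> = map_poly of_int (pCons (M * m) (smult n P))"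
      unfolding MP(2) by (simp add: map_poly_pCons map_poly_smult)
    finally show ?case using MP(1) n by (metis mult_pos_pos)
  qed
  with that show ?thesis by blast
qed

lemma poly_map_poly_of_int [simp]:
  "poly (map_poly of_int p) (of_int x) = (of_int (poly p x) :: 'a::comm_ring_1)"
  by (induction p) (simp_all add: map_poly_pCons)

lemma degree_map_poly_of_int [simp]:
  "degree (map_poly of_int p :: 'a::ring_char_0 poly) = degree p"
  by (intro degree_map_poly) simp

section \<open>Powerful values of separable polynomials\<close>

text \<open>The exponent on the right is \<open>2 * D - \<delta>\<close> with
  \<open>\<delta> = 1 / (2 * D)\<close>, so the hypothesis amounts to
  \<open>x powr \<delta> \<le> E\<close>.\<close>

lemma bounded_of_powr_growth:
  fixes x E :: real and D :: nat
  assumes "x > 0" "D > 0"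
    and "x ^ (2 * D) \<le> E * (x ^ (2 * D - 1)) powr (1 + 1 / (2 * D))"
  shows "x \<le> E powr (2 * D)"
proof -
  define \<delta> :: real where "\<delta> = 1 / (2 * D)"
  have \<delta>: "\<delta> > 0" "2 * D * \<delta> = 1" using assms(2) by (auto simp: \<delta>_def)
  have "x powr (2 * D) = x ^ (2 * D)"
    using assms(1) powr_realpow[of x "2 * D"] by simp
  also have "\<dots> \<le> E * (x ^ (2 * D - 1)) powr (1 + \<delta>)"
    using assms(3) by (simp add: \<delta>_def)
  also have "x ^ (2 * D - 1) = x powr (2 * D - 1)"
    using assms(1,2) powr_realpow[of x "2 * D - 1"] by (simp add: of_nat_diff)
  also have "(x powr (2 * D - 1)) powr (1 + \<delta>) = x powr ((2 * D - 1) * (1 + \<delta>))"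
    by (rule powr_powr)
  also have "(2 * D - 1) * (1 + \<delta>) = 2 * D - \<delta>"
    using \<delta>(2) assms(2) by (simp add: of_nat_diff algebra_simps)
  finally have "x powr (2 * D) \<le> E * x powr (2 * D - \<delta>)" .
  also have "x powr (2 * D) = x powr \<delta> * x powr (2 * D - \<delta>)"
    by (simp add: powr_add[symmetric])
  finally have *: "x powr \<delta> \<le> E"
    using assms(1) by simp
  have "x = (x powr \<delta>) powr (2 * D)"
    using assms(1) \<delta>(2) by (simp add: powr_powr mult.commute)
  also have "\<dots> \<le> E powr (2 * D)"
    using * by (intro powr_mono2) auto
  finally show ?thesis .
qed

text \<open>Up to constants, \<open>B (B - M)\<close> has degree \<open>2 degree B\<close>, but its values have the same prime
  factors as those of \<open>F S\<close>, which has degree only \<open>degree B + 1\<close>.\<close>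
lemma belyi_factorisation_int:
  fixes F :: "int poly"
  assumes "squarefree (map_poly of_int F :: rat poly)"
  obtains B S M L where "degree B > 0" "degree F + degree S = degree B + 1" "S \<noteq> 0"
    "M > 0" "L > 0"
    "\<And>n p. prime p \<Longrightarrow> p dvd poly B n * (poly B n - M) \<Longrightarrow> p dvd L * poly F n * poly S n"
proof -
  let ?f = "map_poly of_int F :: rat poly"
  obtain \<beta> T k where \<beta>: "degree \<beta> > 0" "\<beta> * (\<beta> - 1) = ?f * pderiv \<beta> * T"
    "\<beta> * (\<beta> - 1) dvd (?f * T) ^ k"
    using belyi_factorisation[OF assms] by blast
  obtain V where V: "(?f * T) ^ k = \<beta> * (\<beta> - 1) * V" using \<beta>(3) by blast
  obtain M B where B: "M > 0" "smult (of_int M) \<beta> = map_poly of_int B" by (rule clear_denominators)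
  obtain N S where S: "N > 0" "smult (of_int N) T = map_poly of_int S" by (rule clear_denominators)
  obtain J U where U: "J > 0" "smult (of_int J) V = map_poly of_int U" by (rule clear_denominators)
  have deg: "degree B = degree \<beta>" "degree S = degree T"
    using arg_cong[OF B(2), of degree] arg_cong[OF S(2), of degree] B(1) S(1) by simp_all
  have d1: "degree (\<beta> - 1) = degree \<beta>"
    using \<beta>(1) degree_add_eq_left[of "-1" \<beta>] by simp
  have nz: "\<beta> \<noteq> 0" "\<beta> - 1 \<noteq> 0" "pderiv \<beta> \<noteq> 0"
    using \<beta>(1) d1 by (auto simp: pderiv_eq_0_iff)
  then have nz': "?f \<noteq> 0" "T \<noteq> 0"
    using \<beta>(2) by auto
  have "degree (\<beta> * (\<beta> - 1)) = 2 * degree \<beta>"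
    using nz d1 by (simp add: degree_mult_eq)
  moreover have "degree (?f * pderiv \<beta> * T) = degree F + (degree \<beta> - 1) + degree T"
    using nz nz' by (simp add: degree_mult_eq degree_pderiv)
  ultimately have d2: "degree F + degree S = degree B + 1"
    using \<beta>(1,2) deg by simp
  have S0: "S \<noteq> 0" using S nz' by auto
  \<comment> \<open>The constant \<open>L\<close> is \<open>M * J\<close>: clearing denominators
    multiplies the side of \<open>F\<close> and \<open>S\<close> by \<open>M\<^sup>2 * J\<close>,
    while \<open>N ^ k\<close> goes to the side of \<open>B\<close>.\<close>
  have dvd: "p dvd (M * J) * poly F n * poly S n"
    if p: "prime p" "p dvd poly B n * (poly B n - M)" for n p :: int
  proof -
    let ?x = "of_int n :: rat"
    have vals: "of_int M * poly \<beta> ?x = of_int (poly B n)" "of_int N * poly T ?x = of_int (poly S n)"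
      "of_int J * poly V ?x = of_int (poly U n)"
      using arg_cong[OF B(2), of "\<lambda>p. poly p ?x"] arg_cong[OF S(2), of "\<lambda>p. poly p ?x"]
        arg_cong[OF U(2), of "\<lambda>p. poly p ?x"] by simp_all
    have val: "(of_int (poly F n) * poly T ?x) ^ k = poly \<beta> ?x * (poly \<beta> ?x - 1) * poly V ?x"
      using arg_cong[OF V, of "\<lambda>p. poly p ?x"] by simp
    have "(of_int (M\<^sup>2 * J * (poly F n * poly S n) ^ k) :: rat) =
        of_int M ^ 2 * of_int J * of_int N ^ k * (of_int (poly F n) * poly T ?x) ^ k"
      by (simp add: vals(2)[symmetric] power_mult_distrib)
    also have "\<dots> = of_int N ^ k * (of_int M * poly \<beta> ?x) * (of_int M * poly \<beta> ?x - of_int M) *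
        (of_int J * poly V ?x)"
      unfolding val by (simp add: algebra_simps power2_eq_square)
    also have "\<dots> = of_int (poly B n * (poly B n - M) * (N ^ k * poly U n))"
      unfolding vals by simp
    finally have "M\<^sup>2 * J * (poly F n * poly S n) ^ k = poly B n * (poly B n - M) * (N ^ k * poly U n)"
      unfolding of_int_eq_iff .
    with p(2) have "p dvd M\<^sup>2 * J * (poly F n * poly S n) ^ k"
      by (metis dvd_mult2)
    then have "p dvd M \<or> p dvd J \<or> p dvd poly F n * poly S n"
      using p(1) by (meson prime_dvd_mult_iff prime_dvd_power)
    then show ?thesis by (metis dvd_mult dvd_mult2 mult.assoc)
  qed
  show ?thesis
    by (rule that[OF _ d2 S0 B(1) _ dvd]) (use \<beta>(1) deg B U in auto)
qed

theorem finite_powerful_values: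
  fixes F :: "int poly"
  assumes ABC: "ABC_conjecture"
    and sqf: "squarefree (map_poly of_int F :: rat poly)"
    and deg: "degree F > 2"
  shows "finite {n. \<forall>p. prime p \<longrightarrow> p dvd poly F n \<longrightarrow> p ^ 2 dvd poly F n}" (is "finite ?A")
proof -
  obtain B S M L where B: "degree B > 0" and degS: "degree F + degree S = degree B + 1"
    and S0: "S \<noteq> 0" and M: "M > 0" and L: "L > 0"
    and dvd: "\<And>n p. prime p \<Longrightarrow> p dvd poly B n * (poly B n - M) \<Longrightarrow> p dvd L * poly F n * poly S n"
    using belyi_factorisation_int[OF sqf] by blast
  define D where "D = degree B"
  define \<epsilon> :: real where "\<epsilon> = 1 / (2 * D)"
  have D: "D > 0" "\<epsilon> > 0" using B by (auto simp: D_def \<epsilon>_def)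
  have F0: "F \<noteq> 0" using deg by auto
  obtain C where C: "C > 0" "\<And>u. u > 0 \<Longrightarrow>
      real (u + nat M) \<le> C * real (rad (u * nat M * (u + nat M))) powr (1 + \<epsilon>)"
    using ABC_fixed_summand[OF ABC D(2), of "nat M"] M by auto
  \<comment> \<open>The degree is 2 (D + 1) - deg F, and deg F is at least 3. The estimate is
    carried out for squares, which avoids the half-integral exponent d/2.\<close>
  have "degree (F * S\<^sup>2) \<le> 2 * D - 1"
    using degS deg D(1) F0 S0 by (simp add: degree_mult_eq degree_power_eq D_def)
  then obtain K where K: "K > 0" "\<And>n. n \<noteq> 0 \<Longrightarrow> \<bar>poly (F * S\<^sup>2) n\<bar> \<le> K * \<bar>n\<bar> ^ (2 * D - 1)"
    using poly_int_upper_bound by blast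
  obtain N where N: "N > 0" "\<And>n. \<bar>n\<bar> \<ge> N \<Longrightarrow> \<bar>n\<bar> ^ D \<le> 2 * \<bar>poly B n\<bar>"
    using poly_int_lower_bound[OF B] unfolding D_def by blast
  define c where "c = real_of_int ((L * M)\<^sup>2 * K)"
  define E where "E = 4 * C\<^sup>2 * c powr (1 + \<epsilon>)"
  have bound: "real_of_int \<bar>n\<bar> \<le> E powr (2 * D)"
    if n: "n \<in> ?A" "poly F n \<noteq> 0" "poly S n \<noteq> 0" "\<bar>n\<bar> \<ge> N + 2 * M" for n
  proof -
    have n0: "\<bar>n\<bar> > 0" and nN: "\<bar>n\<bar> \<ge> N" and nM: "\<bar>n\<bar> > 2 * M" using n(4) N(1) M by auto
    have "\<bar>n\<bar> \<le> \<bar>n\<bar> ^ D" using n0 D(1) by (intro self_le_power) auto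
    \<comment> \<open>As |B(n)| exceeds \<open>M\<close>, the values B(n) and B(n) - M are nonzero
      and have the same sign.\<close>
    then have large: "\<bar>poly B n\<bar> > M" using N(2)[OF nN] nM by linarith
    define b where "b = poly B n"
    \<comment> \<open>Taking the smaller absolute value makes \<open>u + nat M\<close> the larger
      one, whatever the sign of \<open>b\<close>.\<close>
    define u where "u = nat (min \<bar>b\<bar> \<bar>b - M\<bar>)"
    have u: "u > 0" "{int u, int (u + nat M)} = {\<bar>b\<bar>, \<bar>b - M\<bar>}"
      using large M by (auto simp: u_def b_def[symmetric] min_def abs_if split: if_splits)
    define R where "R = rad (u * nat M * (u + nat M))"
    have "int (u * (u + nat M)) = \<bar>b * (b - M)\<bar>"
      using u(2) by (auto simp: doubleton_eq_iff abs_mult)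
    then have prod: "\<bar>b * (b - M) * M\<bar> = int (u * nat M * (u + nat M))"
      using M by (simp add: abs_mult mult_ac)
    \<comment> \<open>The summand \<open>M\<close> itself brings in its own primes, hence the factor
      \<open>L * M\<close>.\<close>
    have "R \<le> rad (nat (L * M) * (nat \<bar>poly F n\<bar> * nat \<bar>poly S n\<bar>))"
      unfolding R_def
    proof (rule rad_mono)
      fix p :: nat assume p: "prime p" "p dvd u * nat M * (u + nat M)"
      then have "int p dvd b * (b - M) * M"
        using prod by (metis dvd_abs_iff int_dvd_int_iff)
      then have "int p dvd b * (b - M) \<or> int p dvd M"
        using p(1) by (simp add: prime_dvd_mult_iff)
      then have "int p dvd L * M * (poly F n * poly S n)"
        using dvd[of "int p" n] p(1) unfolding b_def by (metis dvd_mult dvd_mult2 mult.assoc mult.commute prime_nat_int_transfer)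
      also have "\<dots> dvd int (nat (L * M) * (nat \<bar>poly F n\<bar> * nat \<bar>poly S n\<bar>))"
        using L M by (simp add: abs_mult[symmetric])
      finally show "p dvd nat (L * M) * (nat \<bar>poly F n\<bar> * nat \<bar>poly S n\<bar>)"
        unfolding int_dvd_int_iff .
    qed (use n L M in simp)
    also have "\<dots> \<le> rad (nat (L * M)) * (rad (nat \<bar>poly F n\<bar>) * rad (nat \<bar>poly S n\<bar>))"
      using n L M by (intro order.trans[OF rad_mult_le] mult_left_mono rad_mult_le) auto
    \<comment> \<open>Only the radical of F(n) is kept; after squaring, powerfulness bounds it by
      |F(n)|.\<close>
    also have "\<dots> \<le> nat (L * M) * (rad (nat \<bar>poly F n\<bar>) * nat \<bar>poly S n\<bar>)"
      using n L M by (intro mult_mono rad_le) auto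
    finally have "R\<^sup>2 \<le> (nat (L * M) * (rad (nat \<bar>poly F n\<bar>) * nat \<bar>poly S n\<bar>))\<^sup>2"
      by (rule power_mono) simp
    also have "\<dots> = (nat (L * M))\<^sup>2 * ((rad (nat \<bar>poly F n\<bar>))\<^sup>2 * (nat \<bar>poly S n\<bar>)\<^sup>2)"
      by (simp add: power_mult_distrib)
    also have "\<dots> \<le> (nat (L * M))\<^sup>2 * (nat \<bar>poly F n\<bar> * (nat \<bar>poly S n\<bar>)\<^sup>2)"
    proof (intro mult_mono rad_square_le)
      fix p :: nat assume p: "prime p" "p dvd nat \<bar>poly F n\<bar>"
      then have "(int p)\<^sup>2 dvd poly F n"
        using n(1) by (simp add: int_dvd_int_iff[symmetric])
      then show "p\<^sup>2 dvd nat \<bar>poly F n\<bar>"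
        by (simp add: int_dvd_int_iff[symmetric])
    qed (use n in auto)
    finally have "int (R\<^sup>2) \<le> int ((nat (L * M))\<^sup>2 * (nat \<bar>poly F n\<bar> * (nat \<bar>poly S n\<bar>)\<^sup>2))"
      unfolding of_nat_le_iff .
    also have "\<dots> = (L * M)\<^sup>2 * \<bar>poly (F * S\<^sup>2) n\<bar>"
      using L M by (simp add: abs_mult power_abs)
    also have "\<dots> \<le> (L * M)\<^sup>2 * (K * \<bar>n\<bar> ^ (2 * D - 1))"
      using K(2)[of n] n0 by (intro mult_left_mono) auto
    finally have "real_of_int (int (R\<^sup>2)) \<le> real_of_int ((L * M)\<^sup>2 * (K * \<bar>n\<bar> ^ (2 * D - 1)))"
      unfolding of_int_le_iff .
    then have R2: "(real R)\<^sup>2 \<le> c * real_of_int \<bar>n\<bar> ^ (2 * D - 1)"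
      by (simp add: c_def mult_ac)
    have "\<bar>b\<bar> \<le> int (u + nat M)" using u(2) by (auto simp: doubleton_eq_iff)
    then have "real_of_int \<bar>b\<bar> \<le> real (u + nat M)" by linarith
    also have "\<dots> \<le> C * real R powr (1 + \<epsilon>)"
      unfolding R_def by (rule C(2)[OF u(1)])
    finally have bR: "real_of_int \<bar>b\<bar> \<le> C * real R powr (1 + \<epsilon>)" .
    have "\<bar>n\<bar> ^ D \<le> 2 * \<bar>b\<bar>" using N(2)[OF nN] by (simp add: b_def)
    then have "real_of_int (\<bar>n\<bar> ^ D) \<le> real_of_int (2 * \<bar>b\<bar>)" unfolding of_int_le_iff .
    then have "real_of_int \<bar>n\<bar> ^ D \<le> 2 * real_of_int \<bar>b\<bar>" by simp
    also have "\<dots> \<le> 2 * (C * real R powr (1 + \<epsilon>))"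
      using bR by simp
    finally have "(real_of_int \<bar>n\<bar> ^ D)\<^sup>2 \<le> (2 * (C * real R powr (1 + \<epsilon>)))\<^sup>2"
      by (rule power_mono) simp
    also have "\<dots> = 4 * C\<^sup>2 * ((real R)\<^sup>2) powr (1 + \<epsilon>)"
      by (simp add: power_mult_distrib powr_mult power2_eq_square)
    also have "\<dots> \<le> 4 * C\<^sup>2 * (c * real_of_int \<bar>n\<bar> ^ (2 * D - 1)) powr (1 + \<epsilon>)"
      using R2 D(2) by (intro mult_left_mono powr_mono2) auto
    also have "\<dots> = E * (real_of_int \<bar>n\<bar> ^ (2 * D - 1)) powr (1 + \<epsilon>)"
      using K(1) by (simp add: E_def c_def powr_mult)
    finally have "real_of_int \<bar>n\<bar> ^ (2 * D) \<le> E * (real_of_int \<bar>n\<bar> ^ (2 * D - 1)) powr (1 + \<epsilon>)"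
      by (simp add: power_mult[symmetric] mult.commute)
    with n0 D(1) show ?thesis
      unfolding \<epsilon>_def by (intro bounded_of_powr_growth) auto
  qed
  define Z where "Z = max (N + 2 * M) \<lceil>E powr (2 * D)\<rceil>"
  \<comment> \<open>Zeros of \<open>F\<close> count as powerful values, and zeros of
    \<open>S\<close> make the radical estimate void; both sets are finite and are set aside.\<close>
  have "?A \<subseteq> {n. poly F n = 0} \<union> {n. poly S n = 0} \<union> {-Z..Z}"
  proof
    fix n assume n: "n \<in> ?A"
    have "\<bar>n\<bar> \<le> Z" if "poly F n \<noteq> 0" "poly S n \<noteq> 0"
    proof (cases "\<bar>n\<bar> \<ge> N + 2 * M")
      case True
      then show ?thesis using bound[OF n that True] by (simp add: Z_def le_max_iff_disj) linarith
    qed (simp add: Z_def)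
    then show "n \<in> {n. poly F n = 0} \<union> {n. poly S n = 0} \<union> {-Z..Z}"
      by fastforce
  qed
  moreover have "finite ({n. poly F n = 0} \<union> {n. poly S n = 0} \<union> {-Z..Z})"
    using F0 S0 by (simp add: poly_roots_finite)
  ultimately show ?thesis by (rule finite_subset)
qed

section \<open>Squarefreeness over the rationals\<close>

lemma map_poly_mult_hom:
  fixes h :: "'a::comm_ring_1 \<Rightarrow> 'b::comm_ring_1"
  assumes "h 0 = 0" "\<And>x y. h (x + y) = h x + h y" "\<And>x y. h (x * y) = h x * h y"
  shows "map_poly h (p * q) = map_poly h p * map_poly h q"
proof (rule poly_eqI)
  have sum: "h (sum f A) = (\<Sum>i\<in>A. h (f i))" for f and A :: "nat set"
    by (induction A rule: infinite_finite_induct) (simp_all add: assms)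
  show "coeff (map_poly h (p * q)) n = coeff (map_poly h p * map_poly h q) n" for n
    by (simp add: coeff_map_poly coeff_mult assms sum)
qed

text \<open>A nonconstant factor occurring squared over the rationals has a complex zero, which
  would be a repeated root of \<open>f\<close>.\<close>

lemma separable_imp_squarefree_rat:
  assumes "separable_poly f"
  shows "squarefree (map_poly of_int f :: rat poly)"
proof (rule squarefreeI)
  let ?c = "map_poly of_rat :: rat poly \<Rightarrow> complex poly"
  fix x :: "rat poly" assume "x\<^sup>2 dvd map_poly of_int f"
  then obtain y where y: "map_poly of_int f = x * x * y"
    by (auto simp: power2_eq_square)
  have "map_poly of_int f = ?c (map_poly of_int f)"
    by (simp add: map_poly_map_poly o_def)
  also have "\<dots> = ?c x * ?c x * ?c y"
    by (simp add: y map_poly_mult_hom of_rat_add of_rat_mult)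
  finally have f: "map_poly of_int f = ?c x * ?c x * ?c y" .
  have sep: "rsquarefree (?c x * ?c x * ?c y)"
    using assms by (simp add: separable_poly_def f)
  have "degree (?c x) = 0"
  proof (rule ccontr)
    assume "degree (?c x) \<noteq> 0"
    then obtain z where "poly (?c x) z = 0"
      using fundamental_theorem_of_algebra[of "?c x"] by (auto simp: constant_degree)
    then have "poly (?c x * ?c x * ?c y) z = 0" "poly (pderiv (?c x * ?c x * ?c y)) z = 0"
      by (simp_all add: pderiv_mult)
    with sep show False unfolding rsquarefree_roots by blast
  qed
  then have "degree x = 0" by (simp add: degree_map_poly)
  moreover have "x \<noteq> 0" using sep by (auto simp: rsquarefree_def)
  ultimately show "is_unit x" by (simp add: is_unit_iff_degree)
qed

text \<open>Two distinct monic linear factors differ by a nonzero constant and are therefore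
  coprime.\<close>

lemma squarefree_prod_distinct_linear:
  fixes q :: "'i \<Rightarrow> int"
  assumes "finite I" "inj_on q I"
  shows "squarefree (map_poly of_int (\<Prod>i\<in>I. [:q i, 1:]) :: rat poly)"
proof -
  have "map_poly of_int (\<Prod>i\<in>I. [:q i, 1:]) = (\<Prod>i\<in>I. [:of_int (q i), 1:] :: rat poly)"
    using assms(1)
    by (induction I rule: finite_induct) (simp_all add: map_poly_mult_hom map_poly_pCons del: mult_pCons_left mult_pCons_right)
  moreover have "squarefree (\<Prod>i\<in>I. [:of_int (q i), 1:] :: rat poly)"
  proof (rule squarefree_prod_coprime)
    fix i j assume "i \<in> I" "j \<in> I" "i \<noteq> j"
    then have "q i \<noteq> q j" using assms(2) by (auto dest: inj_onD)
    then have "is_unit ([:of_int (q i), 1:] - [:of_int (q j), 1:] :: rat poly)"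
      by (simp add: is_unit_triv)
    then show "coprime [:of_int (q i), 1:] [:of_int (q j), 1 :: rat:]"
      by (meson coprimeI dvd_diff dvd_unit_imp_unit)
  next
    fix i
    show "squarefree [:of_int (q i), 1 :: rat:]"
      by (intro squarefree_prime_elem prime_elem_linear_field_poly) simp
  qed
  ultimately show ?thesis by simp
qed

section \<open>The two Diophantine equations\<close>

lemma finite_poly_fibre:
  fixes p :: "int poly"
  assumes "degree p > 0"
  shows "finite {x. poly p x = c}"
proof -
  have "p - [:c:] \<noteq> 0" using assms by auto
  then have "finite {x. poly (p - [:c:]) x = 0}" by (rule poly_roots_finite)
  then show ?thesis by simp
qed

theorem corollary1p7:
  fixes f :: "int poly" and m :: nat and q :: "nat \<Rightarrow> int"
  assumes "ABC_conjecture"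
    and "degree f > 0"
    and "m > 0"
  shows
    "(separable_poly f \<and> degree f > 2 \<and>
      (\<forall>j\<in>{1..m}. [:q j, 1:] ^ 2 dvd (\<Prod>i=1..m. [:q i, 1:]))
      \<longrightarrow> finite {(x::int, y::int). (\<Prod>i=1..m. y + q i) = poly f x})
     \<and>
     (\<forall>(k::nat) (g :: nat \<Rightarrow> int poly) (l :: nat \<Rightarrow> nat).
        m > 2 \<and> inj_on q {1..m} \<and> k > 0 \<and> (\<forall>i\<in>{1..k}. l i \<ge> 2) \<and>
        f = (\<Prod>i=1..k. g i ^ l i)
        \<longrightarrow> finite {(x::int, y::int). (\<Prod>i=1..m. y + q i) = poly f x})"
proof -
  define Q where "Q = (\<Prod>i=1..m. [:q i, 1:])"
  have degQ: "degree Q = m"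
    by (simp add: Q_def degree_prod_eq_sum_degree)
  have Q: "poly Q y = (\<Prod>i=1..m. y + q i)" for y
    by (simp add: Q_def poly_prod add.commute)
  let ?sol = "{(x, y). poly Q y = poly f x}"
  let ?pow = "\<lambda>n::int. \<forall>p. prime p \<longrightarrow> p dvd n \<longrightarrow> p ^ 2 dvd n"
  have part1: "finite ?sol"
    if "separable_poly f" "degree f > 2" "\<forall>j\<in>{1..m}. [:q j, 1:] ^ 2 dvd Q"
  proof (rule finite_subset)
    \<comment> \<open>A prime dividing Q(y) divides some factor y + q_j, whose square divides Q(y)
      by the divisibility hypothesis.\<close>
    have pow: "?pow (poly Q y)" for y
    proof (intro allI impI)
      fix p :: int assume p: "prime p" "p dvd poly Q y"
      then obtain j where j: "j \<in> {1..m}" "p dvd y + q j"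
        unfolding Q by (auto simp: prime_dvd_prod_iff)
      with that(3) obtain R where "Q = [:q j, 1:] ^ 2 * R" by blast
      then have "poly Q y = (y + q j) ^ 2 * poly R y"
        by (simp add: add.commute)
      with j(2) show "p ^ 2 dvd poly Q y"
        by (simp add: dvd_mult2 dvd_power_same)
    qed
    \<comment> \<open>Finitely many \<open>x\<close> are possible, and over each the fibre in
      \<open>y\<close> is finite because \<open>Q\<close> has degree \<open>m > 0\<close>.\<close>
    show "?sol \<subseteq> (SIGMA x:{x. ?pow (poly f x)}. {y. poly Q y = poly f x})"
      using pow by auto metis
    show "finite (SIGMA x:{x. ?pow (poly f x)}. {y. poly Q y = poly f x})"
      using that assms degQ
      by (intro finite_SigmaI finite_powerful_values separable_imp_squarefree_rat finite_poly_fibre) auto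
  qed
  have part2: "finite ?sol"
    if "m > 2" "inj_on q {1..m}" "\<forall>i\<in>{1..k}. l i \<ge> 2" "f = (\<Prod>i=1..k. g i ^ l i)"
    for k :: nat and g :: "nat \<Rightarrow> int poly" and l :: "nat \<Rightarrow> nat"
  proof (rule finite_subset)
    have pow: "?pow (poly f x)" for x
    proof (intro allI impI)
      fix p :: int assume p: "prime p" "p dvd poly f x"
      have f: "poly f x = (\<Prod>i=1..k. poly (g i) x ^ l i)"
        by (simp add: that(4) poly_prod)
      with p obtain j where j: "j \<in> {1..k}" "p dvd poly (g j) x ^ l j"
        by (auto simp: prime_dvd_prod_iff)
      then have "p ^ l j dvd poly (g j) x ^ l j"
        using p(1) by (meson dvd_power_same prime_dvd_power)
      also have "\<dots> dvd poly f x"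
        unfolding f using j(1) by (intro dvd_prodI) auto
      finally show "p ^ 2 dvd poly f x"
        using that(3) j(1) by (meson dvd_trans le_imp_power_dvd)
    qed
    \<comment> \<open>The roles are exchanged: \<open>y\<close> ranges over a finite set and
      \<open>x\<close> over a fibre of the nonconstant \<open>f\<close>, so the pairs arise in
      swapped order.\<close>
    show "?sol \<subseteq> prod.swap ` (SIGMA y:{y. ?pow (poly Q y)}. {x. poly f x = poly Q y})"
      using pow by (force simp: image_iff)
    show "finite (prod.swap ` (SIGMA y:{y. ?pow (poly Q y)}. {x. poly f x = poly Q y}))"
      using that assms degQ squarefree_prod_distinct_linear[OF _ that(2)]
      by (intro finite_imageI finite_SigmaI finite_powerful_values finite_poly_fibre) (auto simp: Q_def)
  qed
  from part1 part2 show ?thesis unfolding Q Q_def[symmetric] by blast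
qed

end
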